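(* Let $\{X_t\}_{t\in\mathbb{Z}}$, $X_t=\bigoplus_{j=0}^\infty\psi_j\circ Z_{t-j}$ with $\psi_j\in\mathbb{R}$ and $\sum_j|\psi_j|<\infty$, be an invertible MA process in $\mathbb{V}$, that is, there are real numbers $\pi_j$, $j\ge1$, with $$Z_t=X_t\oplus\bigoplus_{j=1}^\infty\pi_j\circ X_{t-j}\qquad\text{for all } t,$$ where $\lim_{x\to\infty}\mathrm{Pr}(Z_j>x)/\{x^{-2}L(x)\}=1$ for all $j$. Let $\hat X_{n+1}$, $\theta_{nj}$ and $\nu_n$ be the one-step predictors, coefficients and squared distances of prediction produced by the transformed-linear innovations algorithm. Then, as $n\to\infty$, (i) $\nu_n\to 1$; (ii) $\|(X_n\ominus\hat X_n)\ominus Z_n\|^2\to0$; (iii) $\theta_{nj}\to\psi_j$ for each $j=1,2,\dots$.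
   Context: Transformed-linear arithmetic: $\tau:\mathbb{R}\to\mathbb{R}_+$ is a fixed bijection with $\lim_{y\to\infty}\tau(y)/y=1$ (the standard example is $\tau(y)=\log(1+e^y)$). For nonnegative random variables $X,Y$ and $a\in\mathbb{R}$, $X\oplus Y=\tau(\tau^{-1}(X)+\tau^{-1}(Y))$, $a\circ X=\tau(a\,\tau^{-1}(X))$, $X\ominus Y=X\oplus((-1)\circ Y)$. Noise: $\{Z_t\}_{t\in\mathbb{Z}}$ are independent nonnegative random variables, regularly varying with tail index $2$ and tail stationary, with $\mathrm{Pr}(Z_t>x)/\{x^{-2}L(x)\}\to1$ for a common slowly varying $L$; they meet the lower-tail condition associated with $\tau$ (for $\tau(y)=\log(1+e^y)$: $s\,\mathrm{Pr}[Z_t\le \exp\{-k\,b(s)\}]\to 0$ as $s\to\infty$ for every $k>0$, with $b(s)$ the normalizing function of regular variation). Space $\mathbb{V}$: all absolutely summable transformed-linear combinations $X=\bigoplus_{j}\psi_{j}\circ Z_j$, $\psi_j\in\mathbb{R}$, $\sum_j|\psi_j|<\infty$ (these series converge with probability one); it is a vector space under $\oplus,\circ$ with zero element $0_{\mathbb{V}}=\tau(0)$. For $X=\bigoplus_j\psi_j\circ Z_j$ and $Y=\bigoplus_j\phi_j\circ Z_j$, the inner product is $\langle X,Y\rangle=\sum_j\psi_j\phi_j$, and $\|X\|=\sqrt{\langle X,X\rangle}$. Thus for the MA process $\langle X_t,X_{t+h}\rangle=\gamma(h)=\sum_{j\ge0}\psi_j\psi_{j+h}$, $h\ge 0$. The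 infinite combination $\bigoplus_{j\ge1}\pi_j\circ X_{t-j}$ is understood as the limit, in the norm $\|\cdot\|$, of its partial combinations. Innovations algorithm: $\hat X_1=0_{\mathbb{V}}$, and for $n\ge1$ $\hat X_{n+1}$ is the orthogonal projection of $X_{n+1}$ on $\mathbb{V}^n=\{\bigoplus_{j=1}^n b_j\circ X_{n+1-j}:b_j\in\mathbb{R}\}$, $\nu_n=\|X_{n+1}\ominus\hat X_{n+1}\|^2$, and $\hat X_{n+1}=\bigoplus_{j=1}^n\theta_{nj}\circ(X_{n+1-j}\ominus\hat X_{n+1-j})$, where $\nu_0=\langle X_1,X_1\rangle$, $\theta_{n,n-k}=\nu_k^{-1}(\langle X_{n+1},X_{k+1}\rangle-\sum_{j=0}^{k-1}\theta_{k,k-j}\theta_{n,n-j}\nu_j)$ for $k=0,\dots,n-1$, and $\nu_n=\langle X_{n+1},X_{n+1}\rangle-\sum_{j=0}^{n-1}\theta_{n,n-j}^2\nu_j$. *)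

theory Defs
  imports "HOL-Probability.Probability"
begin

text \<open>Random variables are functions on the sample space. The map \<open>\<tau>\<close> is a bijection from the
  reals onto the positive reals, so \<open>inv \<tau>\<close> is meaningful on positive values only.\<close>

definition tl_zero :: "(real \<Rightarrow> real) \<Rightarrow> 'w \<Rightarrow> real" where
  "tl_zero \<tau> = (\<lambda>\<omega>. \<tau> 0)"

definition tl_add :: "(real \<Rightarrow> real) \<Rightarrow> ('w \<Rightarrow> real) \<Rightarrow> ('w \<Rightarrow> real) \<Rightarrow> 'w \<Rightarrow> real" where
  "tl_add \<tau> X Y = (\<lambda>\<omega>. \<tau> (inv \<tau> (X \<omega>) + inv \<tau> (Y \<omega>)))"

definition tl_scale :: "(real \<Rightarrow> real) \<Rightarrow> real \<Rightarrow> ('w \<Rightarrow> real) \<Rightarrow> 'w \<Rightarrow> real" where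
  "tl_scale \<tau> a X = (\<lambda>\<omega>. \<tau> (a * inv \<tau> (X \<omega>)))"

definition tl_diff :: "(real \<Rightarrow> real) \<Rightarrow> ('w \<Rightarrow> real) \<Rightarrow> ('w \<Rightarrow> real) \<Rightarrow> 'w \<Rightarrow> real" where
  "tl_diff \<tau> X Y = tl_add \<tau> X (tl_scale \<tau> (-1) Y)"

text \<open>The finite combination of \<open>Y 1, \<dots>, Y n\<close>; the index starts at 1.\<close>

primrec tl_sum :: "(real \<Rightarrow> real) \<Rightarrow> (nat \<Rightarrow> 'w \<Rightarrow> real) \<Rightarrow> nat \<Rightarrow> 'w \<Rightarrow> real" where
  "tl_sum \<tau> Y 0 = tl_zero \<tau>"
| "tl_sum \<tau> Y (Suc n) = tl_add \<tau> (tl_sum \<tau> Y n) (Y (Suc n))"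

text \<open>The random variable \<open>X\<close> is the infinite combination of the \<open>Y j\<close>, \<open>j \<in> A\<close>: with probability
  one the series converges (absolutely) on the \<open>inv \<tau>\<close> scale and \<open>X\<close> is its image under \<open>\<tau>\<close>.\<close>

definition tl_has_sum ::
  "'w measure \<Rightarrow> (real \<Rightarrow> real) \<Rightarrow> ('i \<Rightarrow> 'w \<Rightarrow> real) \<Rightarrow> ('w \<Rightarrow> real) \<Rightarrow> 'i set \<Rightarrow> bool" where
  "tl_has_sum M \<tau> Y X A \<longleftrightarrow> X \<in> borel_measurable M \<and>
     (AE \<omega> in M. \<exists>s. ((\<lambda>j. inv \<tau> (Y j \<omega>)) has_sum s) A \<and> X \<omega> = \<tau> s)"

definition slowly_varying :: "(real \<Rightarrow> real) \<Rightarrow> bool" where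
  "slowly_varying L \<longleftrightarrow> L \<in> borel_measurable borel \<and> (\<forall>\<^sub>F x in at_top. L x > 0) \<and>
     (\<forall>c>0. ((\<lambda>x. L (c * x) / L x) \<longlongrightarrow> 1) at_top)"

definition regularly_varying_with ::
  "'w measure \<Rightarrow> real \<Rightarrow> (real \<Rightarrow> real) \<Rightarrow> ('w \<Rightarrow> real) \<Rightarrow> bool" where
  "regularly_varying_with M \<alpha> b X \<longleftrightarrow> filterlim b at_top at_top \<and>
     (\<forall>x>0. ((\<lambda>s. s * measure M {\<omega> \<in> space M. X \<omega> > b s * x}) \<longlongrightarrow> x powr (-\<alpha>)) at_top)"

text \<open>Measurability of \<open>\<tau>\<close> and \<open>inv \<tau>\<close> makes the operations above map random variables to random
  variables. For \<open>\<tau> y = ln (1 + exp y)\<close> one has \<open>\<tau> (- k * b s) \<sim> exp (- k * b s)\<close>, and the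
  lower-tail condition is equivalent to the one with \<open>exp (- k * b s)\<close> as threshold. Tail
  stationarity is contained in independence together with the tail function \<open>x powr (-2) * L x\<close>
  and the normalizing function \<open>b\<close> being common to all \<open>Z t\<close>.\<close>

locale tl_noise = prob_space M
  for M :: "'w measure" and \<tau> :: "real \<Rightarrow> real" and Z :: "int \<Rightarrow> 'w \<Rightarrow> real"
    and L b :: "real \<Rightarrow> real" +
  assumes bij_tau: "bij_betw \<tau> UNIV {0<..}"
    and measurable_tau: "\<tau> \<in> borel_measurable borel"
    and measurable_inv_tau: "inv \<tau> \<in> borel_measurable borel"
    and tau_asymp: "((\<lambda>y. \<tau> y / y) \<longlongrightarrow> 1) at_top"
    and indep: "indep_vars (\<lambda>_. borel) Z UNIV"
    and nonneg: "\<And>t. AE \<omega> in M. 0 \<le> Z t \<omega>"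
    and slow: "slowly_varying L"
    and tail: "\<And>t. ((\<lambda>x. prob {\<omega> \<in> space M. Z t \<omega> > x} / (x powr (-2) * L x)) \<longlongrightarrow> 1) at_top"
    and regular: "\<And>t. regularly_varying_with M 2 b (Z t)"
    and lower_tail: "\<And>t k. 0 < k \<Longrightarrow>
      ((\<lambda>s. s * prob {\<omega> \<in> space M. Z t \<omega> \<le> \<tau> (- k * b s)}) \<longlongrightarrow> 0) at_top"

definition tl_represents ::
  "'w measure \<Rightarrow> (real \<Rightarrow> real) \<Rightarrow> (int \<Rightarrow> 'w \<Rightarrow> real) \<Rightarrow> (int \<Rightarrow> real) \<Rightarrow> ('w \<Rightarrow> real) \<Rightarrow> bool" where
  "tl_represents M \<tau> Z \<psi> X \<longleftrightarrow> (\<lambda>j. \<bar>\<psi> j\<bar>) summable_on UNIV \<and>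
     tl_has_sum M \<tau> (\<lambda>j. tl_scale \<tau> (\<psi> j) (Z j)) X UNIV"

definition tl_space ::
  "'w measure \<Rightarrow> (real \<Rightarrow> real) \<Rightarrow> (int \<Rightarrow> 'w \<Rightarrow> real) \<Rightarrow> ('w \<Rightarrow> real) set" where
  "tl_space M \<tau> Z = {X. \<exists>\<psi>. tl_represents M \<tau> Z \<psi> X}"

text \<open>The coefficients are unique because the \<open>inv \<tau> (Z j)\<close> are independent and not almost surely
  constant.\<close>

definition tl_coeff ::
  "'w measure \<Rightarrow> (real \<Rightarrow> real) \<Rightarrow> (int \<Rightarrow> 'w \<Rightarrow> real) \<Rightarrow> ('w \<Rightarrow> real) \<Rightarrow> int \<Rightarrow> real" where
  "tl_coeff M \<tau> Z X = (THE \<psi>. tl_represents M \<tau> Z \<psi> X)"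

definition tl_inner ::
  "'w measure \<Rightarrow> (real \<Rightarrow> real) \<Rightarrow> (int \<Rightarrow> 'w \<Rightarrow> real) \<Rightarrow> ('w \<Rightarrow> real) \<Rightarrow> ('w \<Rightarrow> real) \<Rightarrow> real" where
  "tl_inner M \<tau> Z X Y = (\<Sum>\<^sub>\<infinity>j. tl_coeff M \<tau> Z X j * tl_coeff M \<tau> Z Y j)"

definition tl_norm ::
  "'w measure \<Rightarrow> (real \<Rightarrow> real) \<Rightarrow> (int \<Rightarrow> 'w \<Rightarrow> real) \<Rightarrow> ('w \<Rightarrow> real) \<Rightarrow> real" where
  "tl_norm M \<tau> Z X = sqrt (tl_inner M \<tau> Z X X)"

definition tl_norm_lim ::
  "'w measure \<Rightarrow> (real \<Rightarrow> real) \<Rightarrow> (int \<Rightarrow> 'w \<Rightarrow> real) \<Rightarrow> (nat \<Rightarrow> 'w \<Rightarrow> real) \<Rightarrow> ('w \<Rightarrow> real) \<Rightarrow> bool" where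
  "tl_norm_lim M \<tau> Z S W \<longleftrightarrow> W \<in> tl_space M \<tau> Z \<and>
     (\<lambda>n. tl_norm M \<tau> Z (tl_diff \<tau> (S n) W)) \<longlonglongrightarrow> 0"

definition is_tl_projection ::
  "'w measure \<Rightarrow> (real \<Rightarrow> real) \<Rightarrow> (int \<Rightarrow> 'w \<Rightarrow> real) \<Rightarrow> ('w \<Rightarrow> real) set \<Rightarrow> ('w \<Rightarrow> real) \<Rightarrow> ('w \<Rightarrow> real) \<Rightarrow> bool"
  where
  "is_tl_projection M \<tau> Z S X P \<longleftrightarrow>
     P \<in> S \<and> (\<forall>Y\<in>S. tl_inner M \<tau> Z (tl_diff \<tau> X P) Y = 0)"

definition tl_moving_average ::
  "'w measure \<Rightarrow> (real \<Rightarrow> real) \<Rightarrow> (int \<Rightarrow> 'w \<Rightarrow> real) \<Rightarrow> (nat \<Rightarrow> real) \<Rightarrow> (int \<Rightarrow> 'w \<Rightarrow> real) \<Rightarrow> bool" where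
  "tl_moving_average M \<tau> Z \<psi> X \<longleftrightarrow> summable (\<lambda>j. \<bar>\<psi> j\<bar>) \<and>
     (\<forall>t. tl_has_sum M \<tau> (\<lambda>j. tl_scale \<tau> (\<psi> j) (Z (t - int j))) (X t) UNIV)"

definition tl_invertible ::
  "'w measure \<Rightarrow> (real \<Rightarrow> real) \<Rightarrow> (int \<Rightarrow> 'w \<Rightarrow> real) \<Rightarrow> (int \<Rightarrow> 'w \<Rightarrow> real) \<Rightarrow> bool" where
  "tl_invertible M \<tau> Z X \<longleftrightarrow> (\<exists>p :: nat \<Rightarrow> real. \<forall>t. \<exists>W.
     tl_norm_lim M \<tau> Z (\<lambda>n. tl_sum \<tau> (\<lambda>j. tl_scale \<tau> (p j) (X (t - int j))) n) W \<and>
     (AE \<omega> in M. Z t \<omega> = tl_add \<tau> (X t) W \<omega>))"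

definition tl_past :: "(real \<Rightarrow> real) \<Rightarrow> (int \<Rightarrow> 'w \<Rightarrow> real) \<Rightarrow> nat \<Rightarrow> ('w \<Rightarrow> real) set" where
  "tl_past \<tau> X n =
     {tl_sum \<tau> (\<lambda>j. tl_scale \<tau> (c j) (X (int n + 1 - int j))) n | c :: nat \<Rightarrow> real. True}"

text \<open>The value at \<open>0\<close> is immaterial, the process being predicted from time 1 on.\<close>

definition tl_predictor ::
  "'w measure \<Rightarrow> (real \<Rightarrow> real) \<Rightarrow> (int \<Rightarrow> 'w \<Rightarrow> real) \<Rightarrow> (int \<Rightarrow> 'w \<Rightarrow> real) \<Rightarrow> nat \<Rightarrow> 'w \<Rightarrow> real" where
  "tl_predictor M \<tau> Z X n =
     (if n \<le> 1 then tl_zero \<tau>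
      else (SOME P. is_tl_projection M \<tau> Z (tl_past \<tau> X (n - 1)) (X (int n)) P))"

text \<open>The recursion of the innovations algorithm, driven by \<open>\<kappa> i j = \<langle>X\<^sub>i, X\<^sub>j\<rangle>\<close>. Here
  \<open>innov_rtheta \<kappa> n k\<close> is the coefficient \<open>\<theta>\<^sub>n\<^sub>,\<^sub>n\<^sub>-\<^sub>k\<close>, meant for \<open>k < n\<close>, and \<open>innov_nu \<kappa> n\<close> is \<open>\<nu>\<^sub>n\<close>.
  That \<open>\<nu>\<^sub>n\<close> is the squared distance of prediction, and the \<open>\<theta>\<^sub>n\<^sub>j\<close> are the coefficients of the
  predictor in terms of the innovations, is a consequence and is not built into the definition.\<close>

function innov_rtheta :: "(nat \<Rightarrow> nat \<Rightarrow> real) \<Rightarrow> nat \<Rightarrow> nat \<Rightarrow> real"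
  and innov_nu :: "(nat \<Rightarrow> nat \<Rightarrow> real) \<Rightarrow> nat \<Rightarrow> real" where
  "innov_rtheta \<kappa> n k = inverse (innov_nu \<kappa> k) *
     (\<kappa> (n + 1) (k + 1) - (\<Sum>j<k. innov_rtheta \<kappa> k j * innov_rtheta \<kappa> n j * innov_nu \<kappa> j))"
| "innov_nu \<kappa> n = \<kappa> (n + 1) (n + 1) - (\<Sum>j<n. (innov_rtheta \<kappa> n j)\<^sup>2 * innov_nu \<kappa> j)"
  by pat_completeness auto
termination
  by (relation "Wellfounded.measure (case_sum (\<lambda>(\<kappa>, n, k). 2 * k + 1) (\<lambda>(\<kappa>, n). 2 * n))") auto

declare innov_rtheta.simps [simp del] innov_nu.simps [simp del]

definition innov_theta :: "(nat \<Rightarrow> nat \<Rightarrow> real) \<Rightarrow> nat \<Rightarrow> nat \<Rightarrow> real" where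
  "innov_theta \<kappa> n j = innov_rtheta \<kappa> n (n - j)"

definition tl_gram ::
  "'w measure \<Rightarrow> (real \<Rightarrow> real) \<Rightarrow> (int \<Rightarrow> 'w \<Rightarrow> real) \<Rightarrow> (int \<Rightarrow> 'w \<Rightarrow> real) \<Rightarrow> nat \<Rightarrow> nat \<Rightarrow> real" where
  "tl_gram M \<tau> Z X i j = tl_inner M \<tau> Z (X (int i)) (X (int j))"

end

theory Submission
  imports Defs
begin

text \<open>
  An element of the space determines its coefficients. Indeed the variables \<open>inv \<tau> (Z j)\<close> are
  independent and not almost surely constant, and a nontrivial linear relation would make one of
  them a function of the others (\<open>null_series_coeff_zero\<close>). The inner product is thus the one of
  square summable sequences. The noise \<open>Z\<^sub>t\<close> becomes the unit vector \<open>e\<^sub>t\<close>, and \<open>X\<^sub>t\<close> becomes a vector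
  \<open>x\<^sub>t\<close>, the translate by \<open>t\<close> of a fixed absolutely summable sequence that vanishes at positive times.

  Reading the inversion formula at the coordinate of the newest noise gives \<open>\<psi> 0 = 1\<close>. Hence every
  residual \<open>x\<^sub>n\<^sub>+\<^sub>1 - f\<close>, with \<open>f\<close> in the span of \<open>x\<^sub>1, \<dots>, x\<^sub>n\<close>, has coordinate 1 at time \<open>n + 1\<close>, and squared
  norm at least 1. The inversion formula truncated after \<open>n\<close> terms is such a residual. It differs from
  \<open>e\<^sub>n\<^sub>+\<^sub>1\<close> by a vector of squared norm \<open>\<epsilon> n\<close>, which tends to 0 and, by translation, depends on the number
  of terms only; its own squared norm is \<open>1 + \<epsilon> n\<close>. As the prediction residual has the least norm,
  \<open>1 \<le> \<nu>\<^sub>n \<le> 1 + \<epsilon> n\<close> (\<open>one_le_residual\<close>, \<open>orthogonal_residual_le\<close>). This is the first claim. Its distance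
  from the noise has square \<open>\<nu>\<^sub>n - 1\<close> (\<open>ip_sub_unit\<close>), which gives the second.

  The innovations recursion is the Gram-Schmidt process (\<open>innovation_properties\<close>): \<open>\<nu>\<^sub>k\<close> is the squared norm
  of the innovation \<open>u\<^sub>k\<close>, and \<open>\<theta>\<^sub>n\<^sub>j \<nu>\<^sub>n\<^sub>-\<^sub>j = \<langle>x\<^sub>n\<^sub>+\<^sub>1, u\<^sub>n\<^sub>-\<^sub>j\<rangle>\<close>. Since \<open>u\<^sub>n\<^sub>-\<^sub>j\<close> approaches \<open>e\<^sub>n\<^sub>+\<^sub>1\<^sub>-\<^sub>j\<close> and the norm of
  \<open>x\<^sub>n\<^sub>+\<^sub>1\<close> is constant, this inner product approaches the coordinate \<open>\<psi> j\<close> of \<open>x\<^sub>n\<^sub>+\<^sub>1\<close> (\<open>theta_tendsto\<close>).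
\<close>

section \<open>The inner product of absolutely summable coefficient families\<close>

abbreviation abs_sum :: "('i \<Rightarrow> real) \<Rightarrow> bool" where
  "abs_sum c \<equiv> (\<lambda>i. \<bar>c i\<bar>) summable_on UNIV"

definition ip :: "('i \<Rightarrow> real) \<Rightarrow> ('i \<Rightarrow> real) \<Rightarrow> real" where
  "ip c d = (\<Sum>\<^sub>\<infinity>i. c i * d i)"

definition unit_coeff :: "'i \<Rightarrow> 'i \<Rightarrow> real" where
  "unit_coeff k = (\<lambda>i. if i = k then 1 else 0)"

lemma abs_sum_add: "abs_sum c \<Longrightarrow> abs_sum d \<Longrightarrow> abs_sum (\<lambda>i. c i + d i)"
  using Infinite_Sum.abs_summable_on_comparison_test'[OF summable_on_add, of "\<lambda>i. \<bar>c i\<bar>" UNIV "\<lambda>i. \<bar>d i\<bar>" "\<lambda>i. c i + d i"]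
  by (simp add: abs_triangle_ineq)

lemma abs_sum_scale: "abs_sum c \<Longrightarrow> abs_sum (\<lambda>i. a * c i)"
  by (simp add: abs_mult summable_on_cmult_right)

lemma abs_sum_diff: "abs_sum c \<Longrightarrow> abs_sum d \<Longrightarrow> abs_sum (\<lambda>i. c i - d i)"
  using abs_sum_add[of c "\<lambda>i. - 1 * d i"] abs_sum_scale[of d "- 1"] by simp

lemma abs_sum_sum:
  "finite K \<Longrightarrow> (\<And>k. k \<in> K \<Longrightarrow> abs_sum (c k)) \<Longrightarrow> abs_sum (\<lambda>i. \<Sum>k\<in>K. c k i)"
proof (induction K rule: finite_induct)
  case (insert k K)
  have "abs_sum (\<lambda>i. c k i + (\<Sum>k\<in>K. c k i))"
    by (rule abs_sum_add) (use insert in auto)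
  then show ?case using insert.hyps by simp
qed simp

lemma abs_sum_comb:
  "finite K \<Longrightarrow> (\<And>k. k \<in> K \<Longrightarrow> abs_sum (x k)) \<Longrightarrow> abs_sum (\<lambda>i. \<Sum>k\<in>K. a k * x k i)"
  by (intro abs_sum_sum abs_sum_scale)

lemma abs_sum_unit: "abs_sum (unit_coeff k)"
  unfolding summable_on_def
  by (rule exI, rule has_sum_finite_neutralI[where B = "{k}"]) (auto simp: unit_coeff_def)

lemmas abs_sum_intros =
  abs_sum_add abs_sum_diff abs_sum_scale abs_sum_comb abs_sum_unit

text \<open>Absolutely summable families are bounded, so their products are summable: this is why
  \<^term>\<open>ip\<close> is bilinear on them.\<close>

lemma summable_ip:
  assumes "abs_sum c" "abs_sum d"
  shows "(\<lambda>i. c i * d i) summable_on UNIV"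
proof -
  have bound: "\<bar>c i\<bar> \<le> (\<Sum>\<^sub>\<infinity>j. \<bar>c j\<bar>)" for i
    using finite_sum_le_infsum[OF assms(1), of "{i}"] by simp
  have "(\<lambda>i. norm (c i * d i)) summable_on UNIV"
    by (rule Infinite_Sum.abs_summable_on_comparison_test'[where g = "\<lambda>i. (\<Sum>\<^sub>\<infinity>j. \<bar>c j\<bar>) * \<bar>d i\<bar>"])
       (auto simp: abs_mult intro!: mult_right_mono bound summable_on_cmult_right assms)
  then show ?thesis by (rule abs_summable_summable)
qed

lemma ip_commute: "ip c d = ip d c"
  by (simp add: ip_def mult.commute)

lemma ip_add_left:
  assumes "abs_sum c" "abs_sum c'" "abs_sum d"
  shows "ip (\<lambda>i. c i + c' i) d = ip c d + ip c' d"
  unfolding ip_def distrib_right by (intro infsum_add summable_ip assms)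

lemma ip_scale_left: "ip (\<lambda>i. a * c i) d = a * ip c d"
  unfolding ip_def mult.assoc by (rule infsum_cmult_right')

lemma ip_diff_left:
  assumes "abs_sum c" "abs_sum c'" "abs_sum d"
  shows "ip (\<lambda>i. c i - c' i) d = ip c d - ip c' d"
  using ip_add_left[of c "\<lambda>i. - 1 * c' i" d] ip_scale_left[of "- 1" c' d]
    abs_sum_scale[of c' "- 1"] assms by simp

lemma ip_diff_right:
  assumes "abs_sum c" "abs_sum c'" "abs_sum d"
  shows "ip d (\<lambda>i. c i - c' i) = ip d c - ip d c'"
  using ip_diff_left[OF assms] by (simp add: ip_commute)

lemma ip_comb_left:
  assumes "finite K" "\<And>k. k \<in> K \<Longrightarrow> abs_sum (x k)" "abs_sum d"
  shows "ip (\<lambda>i. \<Sum>k\<in>K. a k * x k i) d = (\<Sum>k\<in>K. a k * ip (x k) d)"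
  using assms(1,2)
proof (induction K rule: finite_induct)
  case empty
  show ?case by (simp add: ip_def)
next
  case (insert k K)
  have "ip (\<lambda>i. a k * x k i + (\<Sum>k\<in>K. a k * x k i)) d
      = ip (\<lambda>i. a k * x k i) d + ip (\<lambda>i. \<Sum>k\<in>K. a k * x k i) d"
    by (rule ip_add_left) (use insert assms(3) in \<open>auto intro!: abs_sum_intros\<close>)
  then show ?case using insert by (simp add: ip_scale_left)
qed

lemma ip_comb_right:
  assumes "finite K" "\<And>k. k \<in> K \<Longrightarrow> abs_sum (x k)" "abs_sum d"
  shows "ip d (\<lambda>i. \<Sum>k\<in>K. a k * x k i) = (\<Sum>k\<in>K. a k * ip d (x k))"
  using ip_comb_left[OF assms] by (simp add: ip_commute)

lemma ip_nonneg: "0 \<le> ip c c"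
  unfolding ip_def by (rule infsum_nonneg) simp

lemma square_coord_le_ip:
  assumes "abs_sum c"
  shows "(c i)\<^sup>2 \<le> ip c c"
  using finite_sum_le_infsum[OF summable_ip[OF assms assms], of "{i}"]
  by (simp add: ip_def power2_eq_square)

lemma ip_unit_right: "ip c (unit_coeff k) = c k"
  unfolding ip_def
  by (rule infsumI, rule has_sum_finite_neutralI[where B = "{k}"]) (auto simp: unit_coeff_def)

lemma ip_square_diff:
  assumes "abs_sum c" "abs_sum d"
  shows "ip (\<lambda>i. c i - d i) (\<lambda>i. c i - d i) = ip c c - 2 * ip c d + ip d d"
  using assms by (simp add: ip_diff_left ip_diff_right abs_sum_diff ip_commute)

text \<open>Subtracting the unit vector removes exactly the unit coordinate. This identity turns bounds on
  squared norms of prediction residuals into bounds on their distance from the noise.\<close>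

lemma ip_sub_unit:
  assumes "abs_sum c" "c k = 1"
  shows "ip (\<lambda>i. c i - unit_coeff k i) (\<lambda>i. c i - unit_coeff k i) = ip c c - 1"
  using ip_square_diff[OF assms(1) abs_sum_unit[of k]] assms(2)
  by (simp add: ip_unit_right) (simp add: unit_coeff_def)

lemma ip_Cauchy_Schwarz:
  assumes c: "abs_sum c" and d: "abs_sum d"
  shows "(ip c d)\<^sup>2 \<le> ip c c * ip d d"
proof (cases "ip d d = 0")
  case True
  then have "d i = 0" for i
    using square_coord_le_ip[OF d, of i] by simp
  then show ?thesis by (simp add: ip_def)
next
  case False
  then have pos: "ip d d > 0" using ip_nonneg[of d] by simp
  \<comment> \<open>the minimizer of the quadratic polynomial \<open>t \<mapsto> \<parallel>c - t d\<parallel>\<^sup>2\<close>\<close>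
  define t where "t = ip c d / ip d d"
  have "0 \<le> ip (\<lambda>i. c i - t * d i) (\<lambda>i. c i - t * d i)" by (rule ip_nonneg)
  also have "\<dots> = ip c c - 2 * (t * ip c d) + t * (t * ip d d)"
    using ip_square_diff[OF c abs_sum_scale[OF d], of t]
      ip_scale_left[of t d c] ip_scale_left[of t d "\<lambda>i. t * d i"] ip_scale_left[of t d d]
    by (simp add: ip_commute)
  finally show ?thesis
    using pos by (simp add: t_def power2_eq_square field_simps)
qed

lemma ip_translate: "ip (\<lambda>i::int. c (i - h)) (\<lambda>i. d (i - h)) = ip c d"
  unfolding ip_def
  by (rule infsum_reindex_bij_betw[where f = "\<lambda>i. c i * d i"], rule bij_betw_byWitness[where f' = "\<lambda>i. i + h"]) auto

section \<open>Finite spans and least distance\<close>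

text \<open>The generators are numbered from 1 because the process is predicted from time 1 on.\<close>

definition lin_span :: "(nat \<Rightarrow> 'i \<Rightarrow> real) \<Rightarrow> nat \<Rightarrow> ('i \<Rightarrow> real) set" where
  "lin_span x n = {\<lambda>i. \<Sum>k=1..n. a k * x k i | a. True}"

lemma lin_spanI: "f = (\<lambda>i. \<Sum>k=1..n. a k * x k i) \<Longrightarrow> f \<in> lin_span x n"
  by (auto simp: lin_span_def)

lemma lin_span_comb:
  assumes "\<And>j. j \<in> J \<Longrightarrow> f j \<in> lin_span x n"
  shows "(\<lambda>i. \<Sum>j\<in>J. b j * f j i) \<in> lin_span x n"
proof -
  from assms have "\<forall>j\<in>J. \<exists>a. f j = (\<lambda>i. \<Sum>k=1..n. a k * x k i)"
    by (auto simp: lin_span_def)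
  then obtain a where a: "\<And>j. j \<in> J \<Longrightarrow> f j = (\<lambda>i. \<Sum>k=1..n. a j k * x k i)" by metis
  show ?thesis
  proof (rule lin_spanI)
    show "(\<lambda>i. \<Sum>j\<in>J. b j * f j i) = (\<lambda>i. \<Sum>k=1..n. (\<Sum>j\<in>J. b j * a j k) * x k i)"
      by (auto simp: a sum_distrib_left sum_distrib_right mult.assoc cong: sum.cong intro: sum.swap)
  qed
qed

lemma lin_span_diff:
  assumes "f \<in> lin_span x n" "g \<in> lin_span x n"
  shows "(\<lambda>i. f i - g i) \<in> lin_span x n"
  using lin_span_comb[of "{True, False}" "\<lambda>b. if b then f else g" x n "\<lambda>b. if b then 1 else - 1"]
    assms by simp

lemma lin_span_mono:
  assumes "m \<le> n" "f \<in> lin_span x m"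
  shows "f \<in> lin_span x n"
proof -
  obtain a where a: "f = (\<lambda>i. \<Sum>k=1..m. a k * x k i)"
    using assms(2) by (auto simp: lin_span_def)
  show ?thesis
  proof (rule lin_spanI)
    show "f = (\<lambda>i. \<Sum>k=1..n. (if k \<le> m then a k else 0) * x k i)"
      unfolding a using assms(1) by (intro ext sum.mono_neutral_cong_left) auto
  qed
qed

lemma lin_span_generator:
  assumes "1 \<le> k" "k \<le> n"
  shows "x k \<in> lin_span x n"
proof (rule lin_spanI)
  show "x k = (\<lambda>i. \<Sum>l=1..n. (if l = k then 1 else 0) * x l i)"
    using assms by (auto simp: if_distrib[of "\<lambda>a. a * _"] cong: if_cong)
qed

lemma lin_span_abs_sum: "(\<And>k. abs_sum (x k)) \<Longrightarrow> f \<in> lin_span x n \<Longrightarrow> abs_sum f"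
  by (auto simp: lin_span_def intro!: abs_sum_comb)

lemma ip_lin_span_eq_0:
  assumes "\<And>k. abs_sum (x k)" "abs_sum r" "\<And>k. 1 \<le> k \<Longrightarrow> k \<le> n \<Longrightarrow> ip r (x k) = 0"
    "f \<in> lin_span x n"
  shows "ip r f = 0"
  using assms by (auto simp: lin_span_def ip_comb_right)

text \<open>Pythagoras: another residual differs from the orthogonal one by an element of the span, which is
  orthogonal to it.\<close>

lemma orthogonal_residual_minimal:
  assumes x: "\<And>k. abs_sum (x k)" and y: "abs_sum y"
    and f: "f \<in> lin_span x n" and g: "g \<in> lin_span x n"
    and orth: "\<And>k. 1 \<le> k \<Longrightarrow> k \<le> n \<Longrightarrow> ip (\<lambda>i. y i - f i) (x k) = 0"
  shows "ip (\<lambda>i. y i - f i) (\<lambda>i. y i - f i) \<le> ip (\<lambda>i. y i - g i) (\<lambda>i. y i - g i)"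
proof -
  let ?r = "\<lambda>i. y i - f i" and ?h = "\<lambda>i. g i - f i"
  have r: "abs_sum ?r" and h: "abs_sum ?h"
    using x y f g lin_span_abs_sum by (auto intro!: abs_sum_diff)
  have "ip ?r ?h = 0"
    by (rule ip_lin_span_eq_0[OF x r orth]) (auto intro: lin_span_diff f g)
  then have "ip (\<lambda>i. ?r i - ?h i) (\<lambda>i. ?r i - ?h i) = ip ?r ?r + ip ?h ?h"
    using ip_square_diff[OF r h] by simp
  then show ?thesis using ip_nonneg[of ?h] by simp
qed

section \<open>The innovations recursion as Gram-Schmidt orthogonalization\<close>

text \<open>The coefficient vector of \<open>X\<^sub>n\<^sub>+\<^sub>1\<close> minus its predictor, as the output of the algorithm defines it.
  That it is the residual of an orthogonal projection is proved below.\<close>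

fun innovation :: "(nat \<Rightarrow> 'i \<Rightarrow> real) \<Rightarrow> nat \<Rightarrow> 'i \<Rightarrow> real" where
  "innovation x n = (\<lambda>i. x (n + 1) i
     - (\<Sum>j<n. innov_rtheta (\<lambda>a b. ip (x a) (x b)) n j * innovation x j i))"

declare innovation.simps [simp del]

lemma innovation_in_span:
  "\<exists>f \<in> lin_span x n. innovation x n = (\<lambda>i. x (n + 1) i - f i)"
proof (induction n rule: less_induct)
  case (less n)
  have mem: "innovation x j \<in> lin_span x n" if j: "j < n" for j
  proof -
    obtain f where "f \<in> lin_span x j" and eq: "innovation x j = (\<lambda>i. x (j + 1) i - f i)"
      using less j by blast
    then have f: "f \<in> lin_span x n" using j by (auto intro: lin_span_mono[of j n])
    show ?thesis unfolding eq
      by (rule lin_span_diff[OF lin_span_generator f]) (use j in auto)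
  qed
  have "(\<lambda>i. \<Sum>j<n. innov_rtheta (\<lambda>a b. ip (x a) (x b)) n j * innovation x j i) \<in> lin_span x n"
    by (rule lin_span_comb) (use mem in auto)
  then show ?case
    by (rule bexI[rotated]) (rule innovation.simps)
qed

lemma innovation_abs_sum:
  assumes "\<And>k. abs_sum (x k)"
  shows "abs_sum (innovation x n)"
  using innovation_in_span[of x n] lin_span_abs_sum[OF assms] assms by (auto intro!: abs_sum_diff)

text \<open>Nonvanishing of the innovations says that the vectors are linearly independent. It is needed
  because the recursion divides by \<open>\<nu>\<^sub>k\<close>.\<close>

locale gram_schmidt =
  fixes x :: "nat \<Rightarrow> 'i \<Rightarrow> real"
  assumes abs_sum_x: "\<And>k. abs_sum (x k)"
    and innovation_nonzero: "\<And>n. ip (innovation x n) (innovation x n) \<noteq> 0"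
begin

abbreviation "\<kappa> \<equiv> \<lambda>a b. ip (x a) (x b)"
abbreviation "u \<equiv> innovation x"

lemma abs_sum_u: "abs_sum (u n)"
  by (rule innovation_abs_sum[OF abs_sum_x])

lemma ip_u_left:
  assumes "abs_sum d"
  shows "ip (u n) d = ip (x (n + 1)) d - (\<Sum>j<n. innov_rtheta \<kappa> n j * ip (u j) d)"
  by (subst innovation.simps, subst ip_diff_left)
     (auto intro!: abs_sum_intros abs_sum_x abs_sum_u assms simp: ip_comb_left abs_sum_u assms)

text \<open>The three facts are proved together, since each feeds the others. Given them below \<open>k\<close>, expanding
  \<open>u\<^sub>k\<close> by its definition in \<open>\<langle>u\<^sub>k, u\<^sub>j\<rangle>\<close> leaves \<open>\<langle>x\<^sub>k\<^sub>+\<^sub>1, u\<^sub>j\<rangle> - \<theta> \<nu>\<^sub>j = 0\<close>. With this orthogonality,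
  \<open>\<langle>u\<^sub>k, u\<^sub>k\<rangle> = \<langle>x\<^sub>k\<^sub>+\<^sub>1, u\<^sub>k\<rangle>\<close>, whose expansion is the recursion for \<open>\<nu>\<^sub>k\<close>; and the expansion of
  \<open>\<langle>x\<^sub>n\<^sub>+\<^sub>1, u\<^sub>k\<rangle>\<close> is the recursion for \<open>\<theta>\<close>, multiplied by \<open>\<nu>\<^sub>k\<close>.\<close>

lemma innovation_properties:
  "ip (u k) (u k) = innov_nu \<kappa> k \<and>
   (\<forall>n. ip (x (n + 1)) (u k) = innov_rtheta \<kappa> n k * innov_nu \<kappa> k) \<and>
   (\<forall>j<k. ip (u k) (u j) = 0)"
proof (induction k rule: less_induct)
  case (less k)
  have cross: "ip (x (n + 1)) (u j) = innov_rtheta \<kappa> n j * innov_nu \<kappa> j" if "j < k" for n j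
    using less that by blast
  have diag: "ip (u j) (u j) = innov_nu \<kappa> j" if "j < k" for j
    using less that by blast
  have off: "ip (u l) (u j) = 0" if "j < k" "l < k" "j \<noteq> l" for j l
    using less that by (metis ip_commute linorder_neqE_nat)
  have orth: "ip (u k) (u j) = 0" if j: "j < k" for j
  proof -
    have "(\<Sum>l<k. innov_rtheta \<kappa> k l * ip (u l) (u j))
        = (\<Sum>l<k. if l = j then innov_rtheta \<kappa> k j * innov_nu \<kappa> j else 0)"
      using j by (intro sum.cong) (auto simp: off diag)
    then show ?thesis
      using j by (subst ip_u_left[OF abs_sum_u]) (simp add: cross[simplified])
  qed
  have nu: "ip (u k) (u k) = innov_nu \<kappa> k"
  proof -
    have "ip (u k) (u k) = ip (x (k + 1)) (u k)"
      using ip_u_left[OF abs_sum_u, of k k] orth by (simp add: ip_commute)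
    also have "\<dots> = ip (u k) (x (k + 1))"
      by (rule ip_commute)
    also have "\<dots> = \<kappa> (k + 1) (k + 1)
        - (\<Sum>j<k. innov_rtheta \<kappa> k j * (innov_rtheta \<kappa> k j * innov_nu \<kappa> j))"
      by (subst ip_u_left[OF abs_sum_x]) (simp add: ip_commute[of "u _"] cross[simplified])
    also have "\<dots> = innov_nu \<kappa> k"
      by (simp add: innov_nu.simps[of _ k] power2_eq_square mult.assoc)
    finally show ?thesis .
  qed
  have nz: "innov_nu \<kappa> k \<noteq> 0" using nu innovation_nonzero by metis
  have "ip (x (n + 1)) (u k) = innov_rtheta \<kappa> n k * innov_nu \<kappa> k" for n
  proof -
    have "ip (x (n + 1)) (u k) = ip (u k) (x (n + 1))" by (rule ip_commute)
    also have "\<dots> = \<kappa> (n + 1) (k + 1)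
        - (\<Sum>j<k. innov_rtheta \<kappa> k j * (innov_rtheta \<kappa> n j * innov_nu \<kappa> j))"
      by (subst ip_u_left[OF abs_sum_x]) (simp add: ip_commute[of "u _"] ip_commute[of "x (Suc k)"] cross[simplified])
    also have "\<dots> = innov_rtheta \<kappa> n k * innov_nu \<kappa> k"
      using nz by (simp add: innov_rtheta.simps[of _ n k] mult.assoc)
    finally show ?thesis .
  qed
  with orth nu show ?case by blast
qed

lemma innovation_orthogonal_past:
  assumes "1 \<le> k" "k \<le> n"
  shows "ip (u n) (x k) = 0"
proof -
  obtain l where k: "k = l + 1" and l: "l < n" using assms by (metis Suc_eq_plus1 Suc_le_D Suc_le_eq One_nat_def)
  have "ip (u l) (u n) = ip (x k) (u n) - (\<Sum>j<l. innov_rtheta \<kappa> l j * ip (u j) (u n))"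
    unfolding k by (rule ip_u_left[OF abs_sum_u])
  then show ?thesis
    using innovation_properties[of n] l by (simp add: ip_commute)
qed

end

section \<open>Uniqueness of the coefficients\<close>

context tl_noise
begin

lemma inv_tau_tau [simp]: "inv \<tau> (\<tau> y) = y"
  using bij_tau by (simp add: bij_betw_def)

lemma tau_inv_tau: "0 < z \<Longrightarrow> \<tau> (inv \<tau> z) = z"
  using bij_tau by (simp add: bij_betw_def f_inv_into_f)

lemma tau_pos: "0 < \<tau> y"
  using bij_tau by (auto simp: bij_betw_def)

lemma Z_measurable [measurable]: "Z t \<in> borel_measurable M"
  using indep by (auto simp: indep_vars_def)

lemmas [measurable] = measurable_tau measurable_inv_tau

text \<open>An atom at 0 would lie below every threshold \<open>\<tau> (- k b(s))\<close>, and \<open>s\<close> times its mass would not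
  tend to 0. Positivity matters because \<open>inv \<tau>\<close> is meaningful on positive values only.\<close>

lemma Z_pos: "AE \<omega> in M. 0 < Z t \<omega>"
proof -
  define q where "q = prob {\<omega> \<in> space M. Z t \<omega> \<le> 0}"
  have "((\<lambda>s. s * q) \<longlongrightarrow> 0) at_top"
  proof (rule tendsto_sandwich[OF _ _ tendsto_const lower_tail[of 1 t]])
    show "\<forall>\<^sub>F s in at_top. 0 \<le> s * q"
      using eventually_ge_at_top[of 0] by eventually_elim (simp add: q_def)
    show "\<forall>\<^sub>F s in at_top. s * q \<le> s * prob {\<omega> \<in> space M. Z t \<omega> \<le> \<tau> (- 1 * b s)}"
      using eventually_ge_at_top[of 0]
    proof eventually_elim
      case (elim s)
      have "q \<le> prob {\<omega> \<in> space M. Z t \<omega> \<le> \<tau> (- 1 * b s)}"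
        unfolding q_def using tau_pos[of "- 1 * b s"] by (intro finite_measure_mono) auto
      then show ?case using elim by (rule mult_left_mono)
    qed
  qed simp
  then have "\<forall>\<^sub>F s in at_top. s * q < 1"
    by (rule order_tendstoD) simp
  then have "\<forall>\<^sub>F s in at_top. s * q < 1 \<and> s > 0 \<and> s \<ge> 1 / q"
    using eventually_gt_at_top[of 0] eventually_ge_at_top[of "1 / q"] by eventually_elim simp
  then obtain s where "s * q < 1" "s > 0" "s \<ge> 1 / q"
    using eventually_happens'[OF trivial_limit_at_top_linorder] by blast
  then have "\<not> q > 0" by (auto simp: pos_divide_le_eq)
  then have "q = 0" by (simp add: q_def zero_less_measure_iff)
  then have "AE \<omega> in M. \<not> Z t \<omega> \<le> 0"
    unfolding q_def by (subst AE_iff_measurable[OF _ refl]) (auto simp: emeasure_eq_measure)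
  then show ?thesis by (simp add: not_le)
qed

text \<open>By regular variation \<open>s Pr(Z\<^sub>t > b(s)) \<rightarrow> 1\<close>, so for large \<open>s\<close> the probability is positive but of
  order \<open>1 / s\<close>.\<close>

lemma Z_nondegenerate: "\<exists>x. 0 < prob {\<omega> \<in> space M. Z t \<omega> > x} \<and> prob {\<omega> \<in> space M. Z t \<omega> > x} < 1"
proof -
  have lim: "((\<lambda>s. s * prob {\<omega> \<in> space M. Z t \<omega> > b s}) \<longlongrightarrow> 1) at_top"
  proof -
    have "\<forall>x>0. ((\<lambda>s. s * prob {\<omega> \<in> space M. Z t \<omega> > b s * x}) \<longlongrightarrow> x powr (- 2)) at_top"
      using regular[of t] unfolding regularly_varying_with_def by blast
    from this[rule_format, of 1] show ?thesis by simp
  qed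
  have "\<forall>\<^sub>F s in at_top. s * prob {\<omega> \<in> space M. Z t \<omega> > b s} > 0
      \<and> s * prob {\<omega> \<in> space M. Z t \<omega> > b s} < 2 \<and> s > 2"
    using order_tendstoD(1)[OF lim, of 0] order_tendstoD(2)[OF lim, of 2] eventually_gt_at_top[of 2]
    by (simp add: eventually_conj_iff)
  then obtain s where s: "s * prob {\<omega> \<in> space M. Z t \<omega> > b s} > 0"
      "s * prob {\<omega> \<in> space M. Z t \<omega> > b s} < 2" "s > 2"
    using eventually_happens'[OF trivial_limit_at_top_linorder] by blast
  show ?thesis
  proof (intro exI conjI)
    show "0 < prob {\<omega> \<in> space M. Z t \<omega> > b s}"
      using s by (simp add: zero_less_mult_iff)
    show "prob {\<omega> \<in> space M. Z t \<omega> > b s} < 1"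
    proof (rule ccontr)
      assume "\<not> ?thesis"
      then have "s * 1 \<le> s * prob {\<omega> \<in> space M. Z t \<omega> > b s}"
        using s(3) by (intro mult_left_mono) auto
      then show False using s by linarith
    qed
  qed
qed

text \<open>A summable family over the integers is summed along symmetric windows: this sequence of partial
  sums makes the sum a measurable function of the terms.\<close>

lemma filterlim_int_window:
  "filterlim (\<lambda>n. {- int n..int n} - {k}) (finite_subsets_at_top (UNIV - {k})) sequentially"
  unfolding filterlim_finite_subsets_at_top
proof (intro allI impI)
  fix F :: "int set" assume F: "finite F \<and> F \<subseteq> UNIV - {k}"
  define N where "N = Max (insert 0 ((nat \<circ> abs) ` F))"
  have N: "nat \<bar>i\<bar> \<le> N" if "i \<in> F" for i
    unfolding N_def using F that by (intro Max_ge) auto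
  show "\<forall>\<^sub>F n in sequentially. finite ({- int n..int n} - {k})
      \<and> F \<subseteq> {- int n..int n} - {k} \<and> {- int n..int n} - {k} \<subseteq> UNIV - {k}"
    using eventually_ge_at_top[of N]
  proof eventually_elim
    case (elim n)
    have "i \<in> {- int n..int n}" if "i \<in> F" for i using N[OF that] elim by auto
    then show ?case using F by auto
  qed
qed

text \<open>If \<open>c k \<noteq> 0\<close>, the relation expresses \<open>inv \<tau> (Z k)\<close> almost surely as a function \<open>G\<close> of the other
  terms, of which it is independent. An event \<open>{V \<in> A}\<close> is then almost surely equal to the independent
  event \<open>{G \<in> A}\<close>, so its probability \<open>q\<close> satisfies \<open>q = q\<^sup>2\<close>. For \<open>A = {v. \<tau> v > x}\<close> this
  contradicts the nondegeneracy of \<open>Z k\<close>.\<close>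

lemma null_series_coeff_zero:
  assumes "AE \<omega> in M. ((\<lambda>j. c j * inv \<tau> (Z j \<omega>)) has_sum 0) UNIV"
  shows "c k = 0"
proof (rule ccontr)
  assume ck: "c k \<noteq> 0"
  define V where "V = (\<lambda>j \<omega>. inv \<tau> (Z j \<omega>))"
  have V [measurable]: "V j \<in> borel_measurable M" for j by (simp add: V_def)
  define g where "g = (\<lambda>f :: int \<Rightarrow> real. lim (\<lambda>n. \<Sum>j\<in>{- int n..int n} - {k}. c j * f j) / - c k)"
  define G where "G = (\<lambda>\<omega>. g (restrict (\<lambda>j. V j \<omega>) (UNIV - {k})))"
  have g [measurable]: "g \<in> borel_measurable (PiM (UNIV - {k}) (\<lambda>_. borel))"
    unfolding g_def
    by (intro borel_measurable_divide borel_measurable_lim_metric borel_measurable_sum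
        borel_measurable_times measurable_component_singleton borel_measurable_const) auto
  have "indep_vars (\<lambda>_. borel) V UNIV"
    unfolding V_def by (rule indep_vars_compose2[OF indep]) simp
  then have "indep_var (PiM {k} (\<lambda>_. borel)) (\<lambda>\<omega>. restrict (\<lambda>j. V j \<omega>) {k})
      (PiM (UNIV - {k}) (\<lambda>_. borel)) (\<lambda>\<omega>. restrict (\<lambda>j. V j \<omega>) (UNIV - {k}))"
    by (rule indep_var_restrict) auto
  then have "indep_var borel ((\<lambda>f. f k) \<circ> (\<lambda>\<omega>. restrict (\<lambda>j. V j \<omega>) {k}))
      borel (g \<circ> (\<lambda>\<omega>. restrict (\<lambda>j. V j \<omega>) (UNIV - {k})))"
    by (rule indep_var_compose) (auto intro: measurable_component_singleton g)
  then have ind: "indep_var borel (V k) borel G"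
    by (simp add: comp_def G_def)
  have Gm [measurable]: "G \<in> borel_measurable M"
    using ind by (auto simp: indep_var_rv2)
  have VG: "AE \<omega> in M. V k \<omega> = G \<omega>"
    using assms
  proof eventually_elim
    case (elim \<omega>)
    have "((\<lambda>j. c j * V j \<omega>) has_sum (0 - c k * V k \<omega>)) (UNIV - {k})"
      using elim unfolding V_def[symmetric]
      by (intro has_sum_Diff) (auto simp: V_def intro!: has_sum_finiteI)
    then have "(sum (\<lambda>j. c j * V j \<omega>) \<longlongrightarrow> 0 - c k * V k \<omega>) (finite_subsets_at_top (UNIV - {k}))"
      by (simp only: has_sum_def)
    then have "(\<lambda>n. sum (\<lambda>j. c j * V j \<omega>) ({- int n..int n} - {k})) \<longlonglongrightarrow> 0 - c k * V k \<omega>"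
      by (rule filterlim_compose[OF _ filterlim_int_window])
    then have "lim (\<lambda>n. sum (\<lambda>j. c j * V j \<omega>) ({- int n..int n} - {k})) = - (c k * V k \<omega>)"
      using limI by fastforce
    then show ?case
      using ck by (simp add: G_def g_def)
  qed
  obtain x where x: "0 < prob {\<omega> \<in> space M. Z k \<omega> > x}" "prob {\<omega> \<in> space M. Z k \<omega> > x} < 1"
    using Z_nondegenerate by blast
  define A where "A = {v. \<tau> v > x}"
  have A [measurable]: "A \<in> sets borel" unfolding A_def by measurable
  define q where "q = prob (V k -` A \<inter> space M)"
  have "q = prob ((\<lambda>\<omega>. (V k \<omega>, G \<omega>)) -` (A \<times> A) \<inter> space M)"
    unfolding q_def by (rule measure_eq_AE) (use VG in \<open>auto\<close>)
  also have "\<dots> = q * prob (G -` A \<inter> space M)"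
    unfolding q_def by (rule indep_varD[OF ind A A])
  also have "prob (G -` A \<inter> space M) = q"
    unfolding q_def by (rule measure_eq_AE) (use VG in \<open>auto\<close>)
  finally have "q = q * q" .
  moreover have "q = prob {\<omega> \<in> space M. Z k \<omega> > x}"
    unfolding q_def
  proof (rule measure_eq_AE)
    show "AE \<omega> in M. (\<omega> \<in> V k -` A \<inter> space M) = (\<omega> \<in> {\<omega> \<in> space M. Z k \<omega> > x})"
      using Z_pos[of k] by eventually_elim (auto simp: A_def V_def tau_inv_tau)
  qed auto
  ultimately show False using x by simp
qed

lemma represents_iff:
  "tl_represents M \<tau> Z c X \<longleftrightarrow> abs_sum c \<and> X \<in> borel_measurable M \<and>
     (AE \<omega> in M. \<exists>s. ((\<lambda>j. c j * inv \<tau> (Z j \<omega>)) has_sum s) UNIV \<and> X \<omega> = \<tau> s)"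
  by (simp add: tl_represents_def tl_has_sum_def tl_scale_def)

lemma represents_AE:
  "tl_represents M \<tau> Z c X \<Longrightarrow>
     AE \<omega> in M. \<exists>s. ((\<lambda>j. c j * inv \<tau> (Z j \<omega>)) has_sum s) UNIV \<and> X \<omega> = \<tau> s"
  by (simp add: represents_iff)

lemma represents_unique:
  assumes "tl_represents M \<tau> Z c X" "tl_represents M \<tau> Z d X"
  shows "c = d"
proof
  fix k
  have "AE \<omega> in M. ((\<lambda>j. (c j - d j) * inv \<tau> (Z j \<omega>)) has_sum 0) UNIV"
    using represents_AE[OF assms(1)] represents_AE[OF assms(2)]
  proof eventually_elim
    case (elim \<omega>)
    then obtain s s' where s: "((\<lambda>j. c j * inv \<tau> (Z j \<omega>)) has_sum s) UNIV" "X \<omega> = \<tau> s"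
      and s': "((\<lambda>j. d j * inv \<tau> (Z j \<omega>)) has_sum s') UNIV" "X \<omega> = \<tau> s'"
      by auto
    have "s = s'" using s(2) s'(2) by (metis inv_tau_tau)
    then show ?case
      using has_sum_add[OF s(1) has_sum_cmult_right[OF s'(1), of "- 1"]]
      by (simp add: left_diff_distrib)
  qed
  then have "c k - d k = 0" by (rule null_series_coeff_zero)
  then show "c k = d k" by simp
qed

lemma tl_coeff_eq: "tl_represents M \<tau> Z c X \<Longrightarrow> tl_coeff M \<tau> Z X = c"
  unfolding tl_coeff_def by (rule the_equality) (auto intro: represents_unique)

lemma tl_inner_eq_ip:
  "tl_represents M \<tau> Z c X \<Longrightarrow> tl_represents M \<tau> Z d Y \<Longrightarrow> tl_inner M \<tau> Z X Y = ip c d"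
  by (simp add: tl_inner_def ip_def tl_coeff_eq)

lemma tl_norm_sq_eq_ip: "tl_represents M \<tau> Z c X \<Longrightarrow> (tl_norm M \<tau> Z X)\<^sup>2 = ip c c"
  by (simp add: tl_norm_def tl_inner_eq_ip ip_nonneg)

section \<open>Coefficients of transformed-linear combinations\<close>

lemma represents_abs_sum: "tl_represents M \<tau> Z c X \<Longrightarrow> abs_sum c"
  by (simp add: tl_represents_def)

lemma represents_zero: "tl_represents M \<tau> Z (\<lambda>_. 0) (tl_zero \<tau>)"
  by (auto simp: represents_iff tl_zero_def intro!: AE_I2 exI[of _ 0])

lemma represents_add:
  assumes "tl_represents M \<tau> Z c X" "tl_represents M \<tau> Z d Y"
  shows "tl_represents M \<tau> Z (\<lambda>j. c j + d j) (tl_add \<tau> X Y)"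
  unfolding represents_iff
proof (intro conjI)
  from assms have [measurable]: "X \<in> borel_measurable M" "Y \<in> borel_measurable M"
    by (auto simp: represents_iff)
  show "tl_add \<tau> X Y \<in> borel_measurable M" by (simp add: tl_add_def)
  show "abs_sum (\<lambda>j. c j + d j)" using assms by (intro abs_sum_add represents_abs_sum)
  show "AE \<omega> in M. \<exists>s. ((\<lambda>j. (c j + d j) * inv \<tau> (Z j \<omega>)) has_sum s) UNIV \<and> tl_add \<tau> X Y \<omega> = \<tau> s"
    using represents_AE[OF assms(1)] represents_AE[OF assms(2)]
  proof eventually_elim
    case (elim \<omega>)
    then obtain s s' where "((\<lambda>j. c j * inv \<tau> (Z j \<omega>)) has_sum s) UNIV" "X \<omega> = \<tau> s"
      "((\<lambda>j. d j * inv \<tau> (Z j \<omega>)) has_sum s') UNIV" "Y \<omega> = \<tau> s'"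
      by auto
    then show ?case
      by (intro exI[of _ "s + s'"]) (simp add: tl_add_def distrib_right has_sum_add)
  qed
qed

lemma represents_scale:
  assumes "tl_represents M \<tau> Z c X"
  shows "tl_represents M \<tau> Z (\<lambda>j. a * c j) (tl_scale \<tau> a X)"
  unfolding represents_iff
proof (intro conjI)
  from assms have [measurable]: "X \<in> borel_measurable M" by (simp add: represents_iff)
  show "tl_scale \<tau> a X \<in> borel_measurable M" by (simp add: tl_scale_def)
  show "abs_sum (\<lambda>j. a * c j)" using assms by (intro abs_sum_scale represents_abs_sum)
  show "AE \<omega> in M. \<exists>s. ((\<lambda>j. a * c j * inv \<tau> (Z j \<omega>)) has_sum s) UNIV \<and> tl_scale \<tau> a X \<omega> = \<tau> s"
    using represents_AE[OF assms]
  proof eventually_elim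
    case (elim \<omega>)
    then obtain s where "((\<lambda>j. c j * inv \<tau> (Z j \<omega>)) has_sum s) UNIV" "X \<omega> = \<tau> s"
      by auto
    then show ?case
      by (intro exI[of _ "a * s"]) (simp add: tl_scale_def mult.assoc has_sum_cmult_right)
  qed
qed

lemma represents_diff:
  assumes "tl_represents M \<tau> Z c X" "tl_represents M \<tau> Z d Y"
  shows "tl_represents M \<tau> Z (\<lambda>j. c j - d j) (tl_diff \<tau> X Y)"
  using represents_add[OF assms(1) represents_scale[OF assms(2), of "- 1"]]
  by (simp add: tl_diff_def)

lemma represents_sum:
  assumes "\<And>k. 1 \<le> k \<Longrightarrow> k \<le> n \<Longrightarrow> tl_represents M \<tau> Z (x k) (Y k)"
  shows "tl_represents M \<tau> Z (\<lambda>i. \<Sum>k=1..n. a k * x k i) (tl_sum \<tau> (\<lambda>k. tl_scale \<tau> (a k) (Y k)) n)"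
  using assms
proof (induction n)
  case (Suc n)
  have "tl_represents M \<tau> Z (\<lambda>i. (\<Sum>k=1..n. a k * x k i) + a (Suc n) * x (Suc n) i)
      (tl_add \<tau> (tl_sum \<tau> (\<lambda>k. tl_scale \<tau> (a k) (Y k)) n) (tl_scale \<tau> (a (Suc n)) (Y (Suc n))))"
    using Suc by (intro represents_add represents_scale) auto
  then show ?case by simp
qed (simp add: represents_zero)

text \<open>Almost sure positivity of the noise enters here: \<open>\<tau> (inv \<tau> z) = z\<close> requires \<open>z > 0\<close>.\<close>

lemma represents_noise: "tl_represents M \<tau> Z (unit_coeff t) (Z t)"
  unfolding represents_iff
proof (intro conjI abs_sum_unit Z_measurable)
  show "AE \<omega> in M. \<exists>s. ((\<lambda>j. unit_coeff t j * inv \<tau> (Z j \<omega>)) has_sum s) UNIV \<and> Z t \<omega> = \<tau> s"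
    using Z_pos[of t]
  proof eventually_elim
    case (elim \<omega>)
    have "((\<lambda>j. unit_coeff t j * inv \<tau> (Z j \<omega>)) has_sum inv \<tau> (Z t \<omega>)) UNIV"
      by (rule has_sum_finite_neutralI[where B = "{t}"]) (auto simp: unit_coeff_def)
    then show ?case using elim by (auto simp: tau_inv_tau)
  qed
qed

lemma represents_AE_cong:
  assumes "tl_represents M \<tau> Z c X" "AE \<omega> in M. Y \<omega> = X \<omega>" "Y \<in> borel_measurable M"
  shows "tl_represents M \<tau> Z c Y"
  unfolding represents_iff
proof (intro conjI assms(3) represents_abs_sum[OF assms(1)])
  show "AE \<omega> in M. \<exists>s. ((\<lambda>j. c j * inv \<tau> (Z j \<omega>)) has_sum s) UNIV \<and> Y \<omega> = \<tau> s"
    using represents_AE[OF assms(1)] assms(2) by eventually_elim simp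
qed

end

section \<open>The coefficients of a moving average\<close>

definition ma_coeff :: "(nat \<Rightarrow> real) \<Rightarrow> int \<Rightarrow> int \<Rightarrow> real" where
  "ma_coeff \<psi> t i = (if i \<le> t then \<psi> (nat (t - i)) else 0)"

lemma ma_coeff_has_sum_iff:
  fixes f :: "int \<Rightarrow> real"
  shows "((\<lambda>i. ma_coeff \<psi> t i * f i) has_sum s) UNIV \<longleftrightarrow> ((\<lambda>j. \<psi> j * f (t - int j)) has_sum s) UNIV"
proof -
  have im: "range (\<lambda>j. t - int j) = {..t}"
  proof (intro equalityI subsetI)
    fix i assume "i \<in> {..t}"
    then have "i = t - int (nat (t - i))" by simp
    then show "i \<in> range (\<lambda>j. t - int j)" by blast
  qed auto
  have "((\<lambda>i. ma_coeff \<psi> t i * f i) has_sum s) UNIV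
      \<longleftrightarrow> ((\<lambda>i. ma_coeff \<psi> t i * f i) has_sum s) {..t}"
    by (rule has_sum_cong_neutral) (auto simp: ma_coeff_def)
  also have "\<dots> \<longleftrightarrow> ((\<lambda>j. ma_coeff \<psi> t (t - int j) * f (t - int j)) has_sum s) UNIV"
    by (subst im[symmetric], subst has_sum_reindex) (auto simp: inj_on_def comp_def)
  finally show ?thesis by (simp add: ma_coeff_def)
qed

lemma ma_coeff_abs_sum:
  assumes "summable (\<lambda>j. \<bar>\<psi> j\<bar>)"
  shows "abs_sum (ma_coeff \<psi> t)"
proof -
  have "(\<lambda>j. \<bar>\<psi> j\<bar>) summable_on UNIV"
    using assms by (simp add: summable_on_UNIV_nonneg_real_iff)
  then obtain s where "((\<lambda>j. \<bar>\<psi> j\<bar> * 1) has_sum s) UNIV"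
    by (auto simp: summable_on_def)
  then have "((\<lambda>i. ma_coeff (\<lambda>j. \<bar>\<psi> j\<bar>) t i * 1) has_sum s) UNIV"
    using ma_coeff_has_sum_iff[of "\<lambda>j. \<bar>\<psi> j\<bar>" t "\<lambda>_. 1" s] by simp
  moreover have "ma_coeff (\<lambda>j. \<bar>\<psi> j\<bar>) t i * 1 = \<bar>ma_coeff \<psi> t i\<bar>" for i
    by (simp add: ma_coeff_def)
  ultimately show ?thesis by (auto simp: summable_on_def)
qed

lemma ma_coeff_translate: "ma_coeff \<psi> t = (\<lambda>i. ma_coeff \<psi> 0 (i - t))"
  by (simp add: fun_eq_iff ma_coeff_def)

lemma ip_ma_coeff_self: "ip (ma_coeff \<psi> t) (ma_coeff \<psi> t) = ip (ma_coeff \<psi> 0) (ma_coeff \<psi> 0)"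
  unfolding ma_coeff_translate[of \<psi> t] by (rule ip_translate)

lemma (in tl_noise) represents_ma:
  assumes "tl_moving_average M \<tau> Z \<psi> X"
  shows "tl_represents M \<tau> Z (ma_coeff \<psi> t) (X t)"
  using assms ma_coeff_abs_sum unfolding represents_iff tl_moving_average_def tl_has_sum_def
  by (simp add: tl_scale_def ma_coeff_has_sum_iff)

section \<open>Prediction of an invertible moving average on the level of coefficients\<close>

text \<open>The past is listed backwards in time in \<^const>\<open>tl_past\<close> and forwards in \<^const>\<open>lin_span\<close>; this lemma
  and the next one pass between the two numberings.\<close>

lemma ma_past_in_span:
  "(\<lambda>i. \<Sum>k=1..n. a k * ma_coeff \<psi> (int n + 1 - int k) i) \<in> lin_span (\<lambda>k. ma_coeff \<psi> (int k)) n"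
proof (rule lin_span_comb)
  fix k assume k: "k \<in> {1..n}"
  have "ma_coeff \<psi> (int (n + 1 - k)) \<in> lin_span (\<lambda>k. ma_coeff \<psi> (int k)) n"
    by (rule lin_span_generator) (use k in auto)
  moreover have "int (n + 1 - k) = int n + 1 - int k" using k by auto
  ultimately show "ma_coeff \<psi> (int n + 1 - int k) \<in> lin_span (\<lambda>k. ma_coeff \<psi> (int k)) n" by (simp only:)
qed

lemma span_as_ma_past:
  assumes "f \<in> lin_span (\<lambda>k. ma_coeff \<psi> (int k)) n"
  obtains a where "f = (\<lambda>i. \<Sum>k=1..n. a k * ma_coeff \<psi> (int n + 1 - int k) i)"
proof -
  obtain b where b: "f = (\<lambda>i. \<Sum>k=1..n. b k * ma_coeff \<psi> (int k) i)"
    using assms by (auto simp: lin_span_def)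
  have "f = (\<lambda>i. \<Sum>k=1..n. b (n + 1 - k) * ma_coeff \<psi> (int n + 1 - int k) i)"
  proof
    fix i
    show "f i = (\<Sum>k=1..n. b (n + 1 - k) * ma_coeff \<psi> (int n + 1 - int k) i)"
      unfolding b
      by (rule sum.reindex_bij_witness[where i = "\<lambda>k. n + 1 - k" and j = "\<lambda>k. n + 1 - k"])
         (auto simp: of_nat_diff)
  qed
  then show thesis by (rule that)
qed

definition truncated_inversion :: "(nat \<Rightarrow> real) \<Rightarrow> (nat \<Rightarrow> real) \<Rightarrow> nat \<Rightarrow> int \<Rightarrow> int \<Rightarrow> real" where
  "truncated_inversion \<psi> p n t =
     (\<lambda>i. ma_coeff \<psi> t i + (\<Sum>k=1..n. p k * ma_coeff \<psi> (t - int k) i))"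

text \<open>The squared distance of the truncated inversion from the noise at time 0. By translation
  invariance it is the same at every time.\<close>

definition inversion_error :: "(nat \<Rightarrow> real) \<Rightarrow> (nat \<Rightarrow> real) \<Rightarrow> nat \<Rightarrow> real" where
  "inversion_error \<psi> p n =
     ip (\<lambda>i. truncated_inversion \<psi> p n 0 i - unit_coeff 0 i)
        (\<lambda>i. truncated_inversion \<psi> p n 0 i - unit_coeff 0 i)"

locale invertible_ma =
  fixes \<psi> p :: "nat \<Rightarrow> real"
  assumes summable_psi: "summable (\<lambda>j. \<bar>\<psi> j\<bar>)"
    and inversion: "inversion_error \<psi> p \<longlonglongrightarrow> 0"
begin

abbreviation "x \<equiv> \<lambda>k :: nat. ma_coeff \<psi> (int k)"
abbreviation "truncated \<equiv> truncated_inversion \<psi> p"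
abbreviation "\<epsilon> \<equiv> inversion_error \<psi> p"

lemma abs_sum_ma: "abs_sum (ma_coeff \<psi> t)"
  by (rule ma_coeff_abs_sum[OF summable_psi])

lemma abs_sum_truncated: "abs_sum (truncated n t)"
  unfolding truncated_inversion_def by (intro abs_sum_intros abs_sum_ma) auto

lemma truncated_error: 
  "ip (\<lambda>i. truncated n t i - unit_coeff t i) (\<lambda>i. truncated n t i - unit_coeff t i) = \<epsilon> n"
proof -
  define e where "e = (\<lambda>i. truncated n 0 i - unit_coeff 0 i)"
  have "(\<lambda>i. truncated n t i - unit_coeff t i) = (\<lambda>i. e (i - t))"
  proof
    fix i
    have "ma_coeff \<psi> (t - int k) i = ma_coeff \<psi> (0 - int k) (i - t)" for k
    proof -
      have "t - int k - i = 0 - int k - (i - t)" "i \<le> t - int k \<longleftrightarrow> i - t \<le> 0 - int k" by auto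
      then show ?thesis by (simp only: ma_coeff_def)
    qed
    moreover have "ma_coeff \<psi> t i = ma_coeff \<psi> 0 (i - t)" "unit_coeff t i = unit_coeff 0 (i - t)"
      by (auto simp: ma_coeff_def unit_coeff_def)
    ultimately show "truncated n t i - unit_coeff t i = e (i - t)"
      by (simp add: e_def truncated_inversion_def)
  qed
  then show ?thesis
    by (simp only: ip_translate) (simp add: e_def inversion_error_def)
qed

text \<open>Past values have coordinate 0 at the present time, so there the truncated inversion has
  coordinate \<open>\<psi> 0\<close>, and the noise has coordinate 1.\<close>

lemma psi_0: "\<psi> 0 = 1"
proof -
  have "truncated n 0 0 - unit_coeff 0 0 = \<psi> 0 - 1" for n
    by (simp add: truncated_inversion_def ma_coeff_def unit_coeff_def)
  then have "(\<psi> 0 - 1)\<^sup>2 \<le> \<epsilon> n" for n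
    using square_coord_le_ip[OF abs_sum_diff[OF abs_sum_truncated abs_sum_unit], of n 0 0 0]
    by (simp only: truncated_error \<open>\<And>n. truncated n 0 0 - unit_coeff 0 0 = \<psi> 0 - 1\<close>)
  then have "(\<psi> 0 - 1)\<^sup>2 \<le> 0"
    by (intro tendsto_lowerbound[OF inversion]) auto
  then show ?thesis by simp
qed

lemma residual_coord:
  assumes "f \<in> lin_span x n"
  shows "x (n + 1) (int (n + 1)) - f (int (n + 1)) = 1"
proof -
  have "f (int (n + 1)) = 0"
    using assms by (auto simp: lin_span_def ma_coeff_def)
  then show ?thesis by (simp add: ma_coeff_def psi_0)
qed

lemma truncated_as_residual: "\<exists>g\<in>lin_span x n. truncated n (int (n + 1)) = (\<lambda>i. x (n + 1) i - g i)"
proof (rule bexI)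
  show "(\<lambda>i. \<Sum>k=1..n. - p k * ma_coeff \<psi> (int n + 1 - int k) i) \<in> lin_span x n"
    by (rule ma_past_in_span)
qed (simp add: truncated_inversion_def sum_negf add.commute)

text \<open>The lower bound: the newest noise is absent from the past and cannot be predicted.\<close>

lemma one_le_residual:
  assumes "f \<in> lin_span x n"
  shows "1 \<le> ip (\<lambda>i. x (n + 1) i - f i) (\<lambda>i. x (n + 1) i - f i)"
proof -
  have "abs_sum (\<lambda>i. x (n + 1) i - f i)"
    using lin_span_abs_sum[OF abs_sum_ma assms] by (intro abs_sum_diff abs_sum_ma)
  from square_coord_le_ip[OF this, of "int (n + 1)"] show ?thesis
    by (simp only: residual_coord[OF assms] one_power2)
qed

text \<open>The upper bound: the truncated inversion is a competing residual. It has coordinate 1 at the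
  newest time, hence squared norm \<open>1 + \<epsilon> n\<close>.\<close>

lemma orthogonal_residual_le:
  assumes f: "f \<in> lin_span x n"
    and orth: "\<And>k. 1 \<le> k \<Longrightarrow> k \<le> n \<Longrightarrow> ip (\<lambda>i. x (n + 1) i - f i) (x k) = 0"
  shows "ip (\<lambda>i. x (n + 1) i - f i) (\<lambda>i. x (n + 1) i - f i) \<le> 1 + \<epsilon> n"
proof -
  let ?t = "int (n + 1)"
  obtain g where g: "g \<in> lin_span x n" and eq: "truncated n ?t = (\<lambda>i. x (n + 1) i - g i)"
    using truncated_as_residual by blast
  have "truncated n ?t ?t = 1"
    unfolding eq by (rule residual_coord[OF g])
  then have "ip (truncated n ?t) (truncated n ?t) = 1 + \<epsilon> n"
    using ip_sub_unit[OF abs_sum_truncated, of n ?t ?t] by (simp only: truncated_error)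
  then show ?thesis
    using orthogonal_residual_minimal[OF abs_sum_ma abs_sum_ma f g orth] by (simp only: eq)
qed

lemma one_le_innovation: "1 \<le> ip (innovation x n) (innovation x n)"
  using innovation_in_span[of x n] one_le_residual by auto

sublocale gram_schmidt x
proof
  show "ip (innovation x n) (innovation x n) \<noteq> 0" for n
    using one_le_innovation[of n] by linarith
qed (rule abs_sum_ma)

lemma innovation_coord: "u n (int (n + 1)) = 1"
  using innovation_in_span[of x n] residual_coord by auto

lemma nu_bounds: "1 \<le> innov_nu \<kappa> n" "innov_nu \<kappa> n \<le> 1 + \<epsilon> n"
proof -
  have nu: "innov_nu \<kappa> n = ip (u n) (u n)" using innovation_properties[of n] by simp
  show "1 \<le> innov_nu \<kappa> n" unfolding nu by (rule one_le_innovation)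
  obtain f where f: "f \<in> lin_span x n" and eq: "u n = (\<lambda>i. x (n + 1) i - f i)"
    using innovation_in_span[of x n] by blast
  show "innov_nu \<kappa> n \<le> 1 + \<epsilon> n"
    unfolding nu eq
    by (rule orthogonal_residual_le[OF f]) (simp only: eq[symmetric] innovation_orthogonal_past)
qed

lemma nu_tendsto: "innov_nu \<kappa> \<longlonglongrightarrow> 1"
proof (rule tendsto_sandwich)
  show "(\<lambda>_. 1) \<longlonglongrightarrow> 1" by (rule tendsto_const)
  show "(\<lambda>n. 1 + \<epsilon> n) \<longlonglongrightarrow> 1"
    using tendsto_add[OF tendsto_const[of 1] inversion] by simp
qed (auto simp: nu_bounds)

text \<open>With \<open>k = n - j\<close>, \<open>\<theta>\<^sub>n\<^sub>j \<nu>\<^sub>k = \<langle>x\<^sub>n\<^sub>+\<^sub>1, u\<^sub>k\<rangle>\<close>, and \<open>\<psi> j = \<langle>x\<^sub>n\<^sub>+\<^sub>1, e\<^sub>k\<^sub>+\<^sub>1\<rangle>\<close> is a coordinate of \<open>x\<^sub>n\<^sub>+\<^sub>1\<close>. The norm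
  of \<open>x\<^sub>n\<^sub>+\<^sub>1\<close> does not depend on \<open>n\<close> and \<open>\<parallel>u\<^sub>k - e\<^sub>k\<^sub>+\<^sub>1\<parallel>\<^sup>2 = \<nu>\<^sub>k - 1 \<rightarrow> 0\<close>, so Cauchy-Schwarz gives the limit.\<close>

lemma theta_tendsto: "(\<lambda>n. innov_theta \<kappa> n j) \<longlonglongrightarrow> \<psi> j"
proof -
  define B where "B = ip (ma_coeff \<psi> 0) (ma_coeff \<psi> 0)"
  define r where "r = (\<lambda>k. innov_theta \<kappa> (k + j) j * innov_nu \<kappa> k)"
  have "(r k - \<psi> j)\<^sup>2 \<le> B * (innov_nu \<kappa> k - 1)" for k
  proof -
    let ?X = "x (k + j + 1)" and ?e = "unit_coeff (int (k + 1))"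
    have "ip ?X (u k) = innov_rtheta \<kappa> (k + j) k * innov_nu \<kappa> k"
      using innovation_properties[of k] by blast
    then have "r k = ip ?X (u k)"
      by (simp only: r_def innov_theta_def add_diff_cancel_right')
    moreover have "\<psi> j = ip ?X ?e"
      by (simp add: ip_unit_right ma_coeff_def)
    ultimately have "r k - \<psi> j = ip ?X (\<lambda>i. u k i - ?e i)"
      by (simp only: ip_diff_right[OF abs_sum_u abs_sum_unit abs_sum_ma])
    then have "(r k - \<psi> j)\<^sup>2 \<le> ip ?X ?X * ip (\<lambda>i. u k i - ?e i) (\<lambda>i. u k i - ?e i)"
      by (simp only:) (intro ip_Cauchy_Schwarz abs_sum_ma abs_sum_diff abs_sum_u abs_sum_unit)
    also have "ip ?X ?X = B" unfolding B_def by (rule ip_ma_coeff_self)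
    also have "ip (\<lambda>i. u k i - ?e i) (\<lambda>i. u k i - ?e i) = innov_nu \<kappa> k - 1"
      using ip_sub_unit[OF abs_sum_u innovation_coord] innovation_properties[of k] by simp
    finally show ?thesis .
  qed
  note bound = this
  have lim: "(\<lambda>k. B * (innov_nu \<kappa> k - 1)) \<longlonglongrightarrow> 0"
    using tendsto_mult[OF tendsto_const[of B] tendsto_diff[OF nu_tendsto tendsto_const[of 1]]] by simp
  have "(\<lambda>k. (r k - \<psi> j)\<^sup>2) \<longlonglongrightarrow> 0"
    by (rule tendsto_sandwich[OF _ _ tendsto_const lim]) (simp_all add: bound)
  then have "(\<lambda>k. sqrt ((r k - \<psi> j)\<^sup>2)) \<longlonglongrightarrow> sqrt 0"
    by (rule tendsto_real_sqrt)
  then have "r \<longlonglongrightarrow> \<psi> j"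
    by (simp add: tendsto_rabs_zero_iff LIM_zero_iff)
  then have "(\<lambda>k. r k / innov_nu \<kappa> k) \<longlonglongrightarrow> \<psi> j / 1"
    by (rule tendsto_divide[OF _ nu_tendsto]) simp
  moreover have "r k / innov_nu \<kappa> k = innov_theta \<kappa> (k + j) j" for k
    using nu_bounds(1)[of k] by (simp add: r_def)
  ultimately have "(\<lambda>k. innov_theta \<kappa> (k + j) j) \<longlonglongrightarrow> \<psi> j" by simp
  then show ?thesis by (rule LIMSEQ_offset)
qed

end

section \<open>Invertibility and predictors in the space of random variables\<close>

context tl_noise
begin

text \<open>By uniqueness of coefficients, \<open>Z\<^sub>0 = X\<^sub>0 \<oplus> W\<close> becomes an equation between coefficient vectors, and
  the distance of the partial combinations from \<open>W\<close> is the inversion error. Time 0 suffices, by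
  translation invariance.\<close>

lemma invertible_imp_invertible_ma:
  assumes ma: "tl_moving_average M \<tau> Z \<psi> X" and "tl_invertible M \<tau> Z X"
  obtains p where "invertible_ma \<psi> p"
proof -
  note X = represents_ma[OF ma]
  obtain p W where lim: "tl_norm_lim M \<tau> Z (\<lambda>n. tl_sum \<tau> (\<lambda>j. tl_scale \<tau> (p j) (X (0 - int j))) n) W"
    and Z0: "AE \<omega> in M. Z 0 \<omega> = tl_add \<tau> (X 0) W \<omega>"
    using assms(2) unfolding tl_invertible_def by blast
  obtain w where w: "tl_represents M \<tau> Z w W"
    using lim by (auto simp: tl_norm_lim_def tl_space_def)
  have "tl_represents M \<tau> Z (\<lambda>i. ma_coeff \<psi> 0 i + w i) (Z 0)"
    by (rule represents_AE_cong[OF represents_add[OF X w] Z0]) simp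
  then have "(\<lambda>i. ma_coeff \<psi> 0 i + w i) = unit_coeff 0"
    by (rule represents_unique[OF _ represents_noise])
  then have w_eq: "w i = unit_coeff 0 i - ma_coeff \<psi> 0 i" for i
    by (auto simp: fun_eq_iff algebra_simps dest: spec[of _ i])
  let ?e = "\<lambda>n i. ma_coeff \<psi> 0 i + (\<Sum>k=1..n. p k * ma_coeff \<psi> (0 - int k) i) - unit_coeff 0 i"
  have "(tl_norm M \<tau> Z (tl_diff \<tau> (tl_sum \<tau> (\<lambda>j. tl_scale \<tau> (p j) (X (0 - int j))) n) W))\<^sup>2
      = ip (?e n) (?e n)" for n
  proof -
    have "tl_represents M \<tau> Z (\<lambda>i. (\<Sum>k=1..n. p k * ma_coeff \<psi> (0 - int k) i) - w i)
        (tl_diff \<tau> (tl_sum \<tau> (\<lambda>j. tl_scale \<tau> (p j) (X (0 - int j))) n) W)"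
      by (intro represents_diff represents_sum X w)
    moreover have "(\<lambda>i. (\<Sum>k=1..n. p k * ma_coeff \<psi> (0 - int k) i) - w i) = ?e n"
      by (auto simp: w_eq)
    ultimately show ?thesis by (simp only: tl_norm_sq_eq_ip)
  qed
  moreover have "(\<lambda>n. (tl_norm M \<tau> Z
      (tl_diff \<tau> (tl_sum \<tau> (\<lambda>j. tl_scale \<tau> (p j) (X (0 - int j))) n) W))\<^sup>2) \<longlonglongrightarrow> 0\<^sup>2"
    by (rule tendsto_power) (use lim in \<open>simp add: tl_norm_lim_def\<close>)
  ultimately have "(\<lambda>n. ip (?e n) (?e n)) \<longlonglongrightarrow> 0" by simp
  then have "invertible_ma \<psi> p"
    using ma by unfold_locales (simp_all add: tl_moving_average_def inversion_error_def[abs_def] truncated_inversion_def)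
  then show thesis by (rule that)
qed

text \<open>The innovation computed by the algorithm shows that a projection exists, so the choice in
  \<^const>\<open>tl_predictor\<close> yields one. The residual of the chosen projection is orthogonal to the past by
  definition, and the norm bounds hold for every such residual.\<close>

lemma predictor_represents:
  assumes ma: "tl_moving_average M \<tau> Z \<psi> X" and "invertible_ma \<psi> p"
  defines "x \<equiv> \<lambda>k. ma_coeff \<psi> (int k)"
  obtains f where "f \<in> lin_span x n" "tl_represents M \<tau> Z f (tl_predictor M \<tau> Z X (n + 1))"
    "\<And>k. 1 \<le> k \<Longrightarrow> k \<le> n \<Longrightarrow> ip (\<lambda>i. x (n + 1) i - f i) (x k) = 0"
proof (cases "n = 0")
  case True
  show thesis
  proof (rule that)
    show "(\<lambda>_. 0) \<in> lin_span x n" using True by (intro lin_spanI) simp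
    show "tl_represents M \<tau> Z (\<lambda>_. 0) (tl_predictor M \<tau> Z X (n + 1))"
      using True represents_zero by (simp add: tl_predictor_def)
  qed (use True in auto)
next
  case False
  interpret invertible_ma \<psi> p by fact
  note X = represents_ma[OF ma]
  let ?Y = "\<lambda>a. tl_sum \<tau> (\<lambda>j. tl_scale \<tau> (a j) (X (int n + 1 - int j))) n"
  let ?y = "\<lambda>a i. \<Sum>k=1..n. a k * ma_coeff \<psi> (int n + 1 - int k) i"
  have Y: "tl_represents M \<tau> Z (?y a) (?Y a)" for a
    by (intro represents_sum X)
  have X1: "tl_represents M \<tau> Z (x (n + 1)) (X (int (n + 1)))"
    unfolding x_def by (rule X)
  have past: "tl_past \<tau> X n = range ?Y"
    by (auto simp: tl_past_def)
  have inner: "tl_inner M \<tau> Z (tl_diff \<tau> (X (int (n + 1))) (?Y a)) (?Y b)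
      = ip (\<lambda>i. x (n + 1) i - ?y a i) (?y b)" for a b
    by (rule tl_inner_eq_ip[OF represents_diff[OF X1 Y] Y])
  have projection_iff: "is_tl_projection M \<tau> Z (tl_past \<tau> X n) (X (int (n + 1))) (?Y a)
      \<longleftrightarrow> (\<forall>b. ip (\<lambda>i. x (n + 1) i - ?y a i) (?y b) = 0)" for a
    unfolding is_tl_projection_def past inner[symmetric] by blast
  obtain g where g: "g \<in> lin_span x n" and ug: "u n = (\<lambda>i. x (n + 1) i - g i)"
    unfolding x_def using innovation_in_span by blast
  obtain a where a: "g = ?y a" using g unfolding x_def by (rule span_as_ma_past)
  have "ip (u n) (?y b) = 0" for b
    by (rule ip_lin_span_eq_0[OF abs_sum_ma abs_sum_u innovation_orthogonal_past ma_past_in_span])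
  then have "is_tl_projection M \<tau> Z (tl_past \<tau> X n) (X (int (n + 1))) (?Y a)"
    unfolding projection_iff ug a by blast
  then have "is_tl_projection M \<tau> Z (tl_past \<tau> X n) (X (int (n + 1)))
      (SOME P. is_tl_projection M \<tau> Z (tl_past \<tau> X n) (X (int (n + 1))) P)"
    by (rule someI[where P = "is_tl_projection M \<tau> Z (tl_past \<tau> X n) (X (int (n + 1)))"])
  then have proj: "is_tl_projection M \<tau> Z (tl_past \<tau> X n) (X (int (n + 1)))
      (tl_predictor M \<tau> Z X (n + 1))"
    using False by (simp add: tl_predictor_def)
  then obtain c where c: "tl_predictor M \<tau> Z X (n + 1) = ?Y c"
    by (auto simp: is_tl_projection_def tl_past_def)
  show thesis
  proof (rule that)
    show "?y c \<in> lin_span x n" unfolding x_def by (rule ma_past_in_span)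
    show "tl_represents M \<tau> Z (?y c) (tl_predictor M \<tau> Z X (n + 1))" unfolding c by (rule Y)
    fix k assume "1 \<le> k" "k \<le> n"
    then have "x k \<in> lin_span x n" by (rule lin_span_generator)
    then obtain b where "x k = ?y b" unfolding x_def by (rule span_as_ma_past)
    then show "ip (\<lambda>i. x (n + 1) i - ?y c i) (x k) = 0"
      using proj unfolding c projection_iff by simp
  qed
qed

end

theorem corollary1:
  fixes M :: "'w measure" and \<tau> L b :: "real \<Rightarrow> real"
    and Z X :: "int \<Rightarrow> 'w \<Rightarrow> real" and \<psi> :: "nat \<Rightarrow> real"
  assumes "tl_noise M \<tau> Z L b"
    and "tl_moving_average M \<tau> Z \<psi> X"
    and "tl_invertible M \<tau> Z X"
  shows "(\<lambda>n. innov_nu (tl_gram M \<tau> Z X) n) \<longlonglongrightarrow> 1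
    \<and> (\<lambda>n. (tl_norm M \<tau> Z
          (tl_diff \<tau> (tl_diff \<tau> (X (int n)) (tl_predictor M \<tau> Z X n)) (Z (int n))))\<^sup>2) \<longlonglongrightarrow> 0
    \<and> (\<forall>j\<ge>1. (\<lambda>n. innov_theta (tl_gram M \<tau> Z X) n j) \<longlonglongrightarrow> \<psi> j)"
proof -
  interpret tl_noise M \<tau> Z L b by fact
  note X = represents_ma[OF assms(2)]
  obtain p where inv: "invertible_ma \<psi> p"
    using invertible_imp_invertible_ma[OF assms(2,3)] .
  interpret invertible_ma \<psi> p by (rule inv)
  \<comment> \<open>the algorithm is run on the Gram matrix of the coefficient vectors\<close>
  have gram: "tl_gram M \<tau> Z X = \<kappa>"
    by (intro ext) (simp add: tl_gram_def tl_inner_eq_ip[OF X X])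
  let ?N = "\<lambda>n. (tl_norm M \<tau> Z
    (tl_diff \<tau> (tl_diff \<tau> (X (int n)) (tl_predictor M \<tau> Z X n)) (Z (int n))))\<^sup>2"
  have bound: "?N (n + 1) \<le> \<epsilon> n" for n
  proof -
    let ?t = "int (n + 1)"
    obtain f where f: "f \<in> lin_span x n" "tl_represents M \<tau> Z f (tl_predictor M \<tau> Z X (n + 1))"
      "\<And>k. 1 \<le> k \<Longrightarrow> k \<le> n \<Longrightarrow> ip (\<lambda>i. x (n + 1) i - f i) (x k) = 0"
      using predictor_represents[OF assms(2) inv, of n] by blast
    let ?r = "\<lambda>i. x (n + 1) i - f i"
    have r: "tl_represents M \<tau> Z ?r (tl_diff \<tau> (X ?t) (tl_predictor M \<tau> Z X (n + 1)))"
      by (rule represents_diff[OF X f(2)])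
    have "?N (n + 1) = ip (\<lambda>i. ?r i - unit_coeff ?t i) (\<lambda>i. ?r i - unit_coeff ?t i)"
      by (rule tl_norm_sq_eq_ip[OF represents_diff[OF r represents_noise]])
    also have "\<dots> = ip ?r ?r - 1"
      by (rule ip_sub_unit[OF represents_abs_sum[OF r] residual_coord[OF f(1)]])
    also have "\<dots> \<le> \<epsilon> n"
      using orthogonal_residual_le[OF f(1,3)] by simp
    finally show ?thesis .
  qed
  have "(\<lambda>n. ?N (n + 1)) \<longlonglongrightarrow> 0"
    by (rule tendsto_sandwich[OF _ _ tendsto_const inversion])
       (simp_all only: bound zero_le_power2 eventually_True)
  then have "?N \<longlonglongrightarrow> 0" by (rule LIMSEQ_offset)
  then show ?thesis
    unfolding gram using nu_tendsto theta_tendsto by blast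
qed

end
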